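(* Let $q,s$ be integers with $1\le s\le q$, and let $RR_1(q,s)=RR(x+qy=z,\;x+sy=z)$. Then $$RR_1(q,s)=\begin{cases}2q+2\left\lfloor\frac{q+1}{2}\right\rfloor+1 & \text{for } s=1,\\ (q+1)(s+1)+s & \text{for } s\ge 2.\end{cases}$$
   Context: For two linear homogeneous equations $\mathcal{E},\mathcal{E}'$ with integer coefficients, each in at least three variables, $RR(\mathcal{E},\mathcal{E}')$ denotes the minimum integer $N$, if it exists, such that any $2$-coloring of $[1,N]=\{1,2,\dots,N\}$ admits either a solution to $\mathcal{E}$ with all entries in $[1,N]$ and of the first color, or a solution to $\mathcal{E}'$ with all entries in $[1,N]$ and of the second color. Entries of solutions need not be distinct. Here the equations are in the variables $x,y,z$. *)

theory Defs
  imports Complex_Main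
begin

text \<open>
  A homogeneous linear equation with integer coefficients
  \<open>a\<^sub>0 x\<^sub>0 + \<dots> + a\<^sub>m x\<^sub>m = 0\<close> is represented by its coefficient list \<open>[a\<^sub>0, \<dots>, a\<^sub>m]\<close>.
  The entries of a solution need not be distinct.
\<close>

definition is_solution :: "int list \<Rightarrow> int list \<Rightarrow> bool" where
  "is_solution as xs \<longleftrightarrow>
     length xs = length as \<and> (\<Sum>i<length as. as ! i * xs ! i) = 0"

definition has_solution_in :: "int list \<Rightarrow> int set \<Rightarrow> bool" where
  "has_solution_in as A \<longleftrightarrow> (\<exists>xs. is_solution as xs \<and> set xs \<subseteq> A)"

definition rado_forcing :: "int list \<Rightarrow> int list \<Rightarrow> int \<Rightarrow> bool" where
  "rado_forcing as bs N \<longleftrightarrow>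
     (\<forall>c :: int \<Rightarrow> nat. c ` {1..N} \<subseteq> {1, 2} \<longrightarrow>
        has_solution_in as {x \<in> {1..N}. c x = 1} \<or>
        has_solution_in bs {x \<in> {1..N}. c x = 2})"

text \<open>
  The off-diagonal two-colour Rado number, with value \<open>None\<close> if there is no such \<open>N\<close>.
  It is intended for equations in at least three variables.
  The bound \<open>1 \<le> N\<close> guarantees that \<open>LEAST\<close> over the integers picks an actual minimum.
\<close>

definition RR :: "int list \<Rightarrow> int list \<Rightarrow> int option" where
  "RR as bs =
     (if \<exists>N\<ge>1. rado_forcing as bs N
      then Some (LEAST N. 1 \<le> N \<and> rado_forcing as bs N)
      else None)"

text \<open>The equations \<open>x + q y = z\<close> and \<open>x + s y = z\<close>, in the variables \<open>x, y, z\<close>.\<close>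

definition RR1 :: "int \<Rightarrow> int \<Rightarrow> int option" where
  "RR1 q s = RR [1, q, -1] [1, s, -1]"

end

theory Submission
  imports Defs
begin

text \<open>
  Call the first colour red and the second blue.  For \<open>s \<ge> 2\<close> the extremal colouring is red exactly
  on \<open>[s + 1, (q + 1) (s + 1) - 1]\<close>; for \<open>s = 1\<close> one can do better by making the odd numbers below
  \<open>q + 1\<close> and the even numbers from \<open>2 q + 2\<close> on blue.

  For the upper bound, either colour of \<open>1\<close> leads to a contradiction.  If \<open>s = 1\<close> and \<open>1\<close> is blue,
  then \<open>2\<close> is red, \<open>2 q + 2\<close> is blue, and all odd numbers up to \<open>q + 1\<close> (up to \<open>q + 2\<close> for odd
  \<open>q\<close>) are inductively forced to be blue, yet two of them add up to \<open>2 q + 2\<close>; a red \<open>1\<close> is refuted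
  by a short chain of forced colours.  If \<open>s \<ge> 2\<close>, note that a red \<open>y\<close> makes colours flip from red
  to blue under translation by \<open>q y\<close>, and a blue \<open>y\<close> makes them flip from blue to red under
  translation by \<open>s y\<close>.  One shows that \<open>2\<close> has the colour opposite to that of \<open>1\<close>.  Then neither
  colour is possible for \<open>4\<close>, because a translation by \<open>4 s\<close> or \<open>4 q\<close> is composed of an even number
  of colour flips; very small \<open>s\<close> or \<open>q\<close>, where the interval is too short for this, are treated
  separately.
\<close>

section \<open>From Rado numbers to colourings without solutions\<close>

lemma has_solution_in_iff:
  "has_solution_in [1, k, -1] A \<longleftrightarrow> (\<exists>x\<in>A. \<exists>y\<in>A. x + k * y \<in> A)"
proof
  assume "has_solution_in [1, k, -1] A"
  then obtain xs where len: "length xs = 3" and sum: "(\<Sum>i<3. [1, k, -1] ! i * xs ! i) = 0"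
    and sub: "set xs \<subseteq> A"
    by (auto simp: has_solution_in_def is_solution_def eval_nat_numeral)
  from len obtain x y z where xs: "xs = [x, y, z]"
    by (auto simp: eval_nat_numeral length_Suc_conv)
  from sum have "z = x + k * y"
    by (simp add: xs eval_nat_numeral)
  with sub show "\<exists>x\<in>A. \<exists>y\<in>A. x + k * y \<in> A"
    by (auto simp: xs)
next
  assume "\<exists>x\<in>A. \<exists>y\<in>A. x + k * y \<in> A"
  then obtain x y where "x \<in> A" "y \<in> A" "x + k * y \<in> A" by blast
  then show "has_solution_in [1, k, -1] A"
    unfolding has_solution_in_def is_solution_def
    by (intro exI[of _ "[x, y, x + k * y]"]) (simp add: eval_nat_numeral)
qed

text \<open>Upper bounds on \<open>x\<close> and \<open>y\<close> are left out: for positive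
  coefficients they follow from the bound on the sum.\<close>

locale good_colouring =
  fixes q s N :: int and R :: "int \<Rightarrow> bool"
  assumes red: "\<lbrakk>1 \<le> x; 1 \<le> y; x + q * y \<le> N; R x; R y\<rbrakk> \<Longrightarrow> \<not> R (x + q * y)"
    and blue: "\<lbrakk>1 \<le> x; 1 \<le> y; x + s * y \<le> N; \<not> R x; \<not> R y\<rbrakk> \<Longrightarrow> R (x + s * y)"
begin

text \<open>Made for chains of forced colours: \<open>z\<close> is a variable of its own, so that a
  sum can be named in simplified form, and any two of the three colours can force the third.\<close>

lemma redD: "\<lbrakk>x + q * y = z; z \<le> N; 1 \<le> x; 1 \<le> y\<rbrakk> \<Longrightarrow> \<not> (R x \<and> R y \<and> R z)"
  using red by blast

lemma blueD: "\<lbrakk>x + s * y = z; z \<le> N; 1 \<le> x; 1 \<le> y\<rbrakk> \<Longrightarrow> R x \<or> R y \<or> R z"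
  using blue by blast

end

lemma good_colouring_mono:
  "good_colouring q s N R \<Longrightarrow> M \<le> N \<Longrightarrow> good_colouring q s M R"
  by (force simp: good_colouring_def)

lemma rado_forcing_iff:
  assumes "1 \<le> q" "1 \<le> s"
  shows "rado_forcing [1, q, -1] [1, s, -1] N \<longleftrightarrow> (\<forall>R. \<not> good_colouring q s N R)"
proof
  assume forcing: "rado_forcing [1, q, -1] [1, s, -1] N"
  show "\<forall>R. \<not> good_colouring q s N R"
  proof (intro allI notI)
    fix R assume "good_colouring q s N R"
    then interpret good_colouring q s N R .
    let ?c = "\<lambda>x. if R x then 1 else 2 :: nat"
    have "?c ` {1..N} \<subseteq> {1, 2}" by auto
    with forcing have "has_solution_in [1, q, -1] {x \<in> {1..N}. ?c x = 1} \<or>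
        has_solution_in [1, s, -1] {x \<in> {1..N}. ?c x = 2}"
      unfolding rado_forcing_def by (elim allE[of _ ?c]) simp
    moreover have "{x \<in> {1..N}. ?c x = 1} = {x \<in> {1..N}. R x}"
      and "{x \<in> {1..N}. ?c x = 2} = {x \<in> {1..N}. \<not> R x}"
      by auto
    ultimately show False
      unfolding has_solution_in_iff using red blue by (elim disjE bexE) auto
  qed
next
  assume none: "\<forall>R. \<not> good_colouring q s N R"
  show "rado_forcing [1, q, -1] [1, s, -1] N"
    unfolding rado_forcing_def
  proof (intro allI impI)
    fix c :: "int \<Rightarrow> nat"
    assume c: "c ` {1..N} \<subseteq> {1, 2}"
    have sol: "has_solution_in [1, k, -1] {x \<in> {1..N}. c x = i}"
      if "1 \<le> k" "1 \<le> x" "1 \<le> y" "x + k * y \<le> N" "c x = i" "c y = i" "c (x + k * y) = i"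
      for k x y i
    proof -
      have "1 * y \<le> k * y" using that by (intro mult_right_mono) auto
      then have "x \<in> {1..N}" "y \<in> {1..N}" "x + k * y \<in> {1..N}"
        unfolding atLeastAtMost_iff using that by linarith+
      then show ?thesis
        unfolding has_solution_in_iff using that(5-7)
        by (intro bexI[of _ x] bexI[of _ y] CollectI conjI)
    qed
    have two: "c x = 2" if "c x \<noteq> 1" "x \<in> {1..N}" for x
      using c that by (auto simp: image_subset_iff)
    show "has_solution_in [1, q, -1] {x \<in> {1..N}. c x = 1} \<or>
        has_solution_in [1, s, -1] {x \<in> {1..N}. c x = 2}"
    proof (rule ccontr)
      assume no_sol: "\<not> ?thesis"
      have "good_colouring q s N (\<lambda>x. c x = 1)"
      proof
        fix x y
        assume "1 \<le> x" "1 \<le> y" "x + q * y \<le> N" "c x = 1" "c y = 1"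
        then show "c (x + q * y) \<noteq> 1"
          using no_sol sol[of q x y 1] assms by blast
      next
        fix x y
        assume *: "1 \<le> x" "1 \<le> y" "x + s * y \<le> N" "c x \<noteq> 1" "c y \<noteq> 1"
        have "1 * y \<le> s * y" using * assms by (intro mult_right_mono) auto
        then have "x \<in> {1..N}" "y \<in> {1..N}" "x + s * y \<in> {1..N}"
          unfolding atLeastAtMost_iff using * by linarith+
        then have "c x = 2" "c y = 2" and z: "c (x + s * y) \<noteq> 1 \<Longrightarrow> c (x + s * y) = 2"
          using * two by blast+
        show "c (x + s * y) = 1"
        proof (rule ccontr)
          assume "c (x + s * y) \<noteq> 1"
          then have "has_solution_in [1, s, -1] {x \<in> {1..N}. c x = 2}"
            using sol[of s x y 2] * assms z \<open>c x = 2\<close> \<open>c y = 2\<close> by blast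
          with no_sol show False by blast
        qed
      qed
      with none show False by simp
    qed
  qed
qed

lemma RR1_eqI:
  assumes "1 \<le> M" "1 \<le> q" "1 \<le> s"
    and lower: "good_colouring q s (M - 1) R"
    and upper: "\<And>R. \<not> good_colouring q s M R"
  shows "RR1 q s = Some M"
proof -
  have forcing: "rado_forcing [1, q, -1] [1, s, -1] M"
    using assms by (simp add: rado_forcing_iff)
  have "(LEAST N. 1 \<le> N \<and> rado_forcing [1, q, -1] [1, s, -1] N) = M"
  proof (rule Least_equality)
    fix N assume "1 \<le> N \<and> rado_forcing [1, q, -1] [1, s, -1] N"
    then have "\<not> good_colouring q s N R"
      using assms by (simp add: rado_forcing_iff)
    then show "M \<le> N"
      using good_colouring_mono[OF lower, of N] by linarith
  qed (use forcing \<open>1 \<le> M\<close> in simp)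
  then show ?thesis
    using forcing \<open>1 \<le> M\<close> unfolding RR1_def RR_def by auto
qed

section \<open>Lower bound: the extremal colourings\<close>

lemma good_colouring_interval:
  fixes q s :: int
  assumes "1 \<le> s" "s \<le> q"
  shows "good_colouring q s ((q + 1) * (s + 1) + s - 1)
    (\<lambda>x. s + 1 \<le> x \<and> x < (q + 1) * (s + 1))"
proof
  fix x y :: int
  assume "s + 1 \<le> x \<and> x < (q + 1) * (s + 1)" "s + 1 \<le> y \<and> y < (q + 1) * (s + 1)"
  then show "\<not> (s + 1 \<le> x + q * y \<and> x + q * y < (q + 1) * (s + 1))"
    using assms mult_left_mono[of "s + 1" y q] by (simp add: algebra_simps)
next
  fix x y :: int
  assume pos: "1 \<le> x" "1 \<le> y" and le: "x + s * y \<le> (q + 1) * (s + 1) + s - 1"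
    and x: "\<not> (s + 1 \<le> x \<and> x < (q + 1) * (s + 1))"
    and y: "\<not> (s + 1 \<le> y \<and> y < (q + 1) * (s + 1))"
  have sy: "s * 1 \<le> s * y" using assms pos by (intro mult_left_mono) auto
  have xs: "x \<le> s" using x le sy by linarith
  have "y \<le> s"
  proof (rule ccontr)
    assume "\<not> y \<le> s"
    then have "(q + 1) * (s + 1) \<le> y" using y by linarith
    then have "s * ((q + 1) * (s + 1)) \<le> s * y" using assms by (intro mult_left_mono) auto
    \<comment> \<open>With K = (q + 1)(s + 1) this says s K \<ge> K + s - 1, so x + s y \<ge> K + s
      leaves the interval.\<close>
    moreover have "0 \<le> (s - 1) * ((q + 1) * (s + 1) - 1)"
      using assms by (intro mult_nonneg_nonneg) (auto simp: algebra_simps)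
    moreover have "(s - 1) * ((q + 1) * (s + 1) - 1) =
        s * ((q + 1) * (s + 1)) - (q + 1) * (s + 1) - s + 1"
      by (simp add: algebra_simps)
    ultimately show False
      using le pos by linarith
  qed
  then have "s * y \<le> s * s" using assms by (intro mult_left_mono) auto
  moreover have "s * s \<le> q * s" using assms by (intro mult_right_mono) auto
  moreover have "(q + 1) * (s + 1) = q * s + q + s + 1" by (simp add: algebra_simps)
  ultimately show "s + 1 \<le> x + s * y \<and> x + s * y < (q + 1) * (s + 1)"
    using xs pos sy assms by linarith
qed

text \<open>In a red solution y = 2, because 1 is blue and 2 + 3 q exceeds 2 q + 2 m. Then x \<le> 2
  m must be even, and x + 2 q is an even number from 2 q + 2 on. Two blue odd numbers have an even
  sum of at most 4 m - 2 \<le> 2 q; a blue odd and a blue even number have an odd sum above 2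
  m.\<close>

lemma good_colouring_parity:
  fixes q m :: int
  assumes "1 \<le> q" "q \<le> 2 * m" "2 * m \<le> q + 1"
  shows "good_colouring q 1 (2 * q + 2 * m)
    (\<lambda>x. \<not> (odd x \<and> x < 2 * m) \<and> \<not> (even x \<and> 2 * q + 2 \<le> x))"
    (is "good_colouring _ _ _ ?R")
proof
  fix x y :: int
  assume pos: "1 \<le> x" "1 \<le> y" and le: "x + q * y \<le> 2 * q + 2 * m" and R: "?R x" "?R y"
  have "1 < 2 * m" using assms by presburger
  then have x1: "x \<noteq> 1" and "y \<noteq> 1"
    using R by auto
  have "y < 3"
  proof (rule ccontr)
    assume "\<not> y < 3"
    then have "q * 3 \<le> q * y" using assms by (intro mult_left_mono) auto
    then show False using le assms x1 pos by linarith
  qed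
  then have "y = 2" using pos \<open>y \<noteq> 1\<close> by linarith
  have "even x" using R le assms unfolding \<open>y = 2\<close> by (auto elim!: evenE oddE)
  then show "\<not> ?R (x + q * y)"
    unfolding \<open>y = 2\<close> using pos x1 by auto
next
  fix x y :: int
  assume "1 \<le> x" "1 \<le> y" "x + 1 * y \<le> 2 * q + 2 * m" "\<not> ?R x" "\<not> ?R y"
  then show "?R (x + 1 * y)"
    using assms by (auto; presburger)
qed

section \<open>Upper bound: chains of forced colours\<close>

context good_colouring
begin

lemma not_red_one_if_s_eq_1:
  assumes "s = 1" "1 \<le> q" "2 * q + 3 \<le> N"
  shows "\<not> R 1"
proof
  assume R1: "R 1"
  have 1: "\<not> R (q + 1)" using R1 redD[of 1 1 "q + 1"] assms by auto
  have 2: "R (2 * q + 2)" using 1 blueD[of "q + 1" "q + 1" "2 * q + 2"] assms by auto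
  have 3: "\<not> R 2" using 2 redD[of 2 2 "2 * q + 2"] assms by auto
  have 4: "\<not> R (q + 2)" using R1 2 redD[of "q + 2" 1 "2 * q + 2"] assms by auto
  have 5: "R 4" using 3 blueD[of 2 2 4] assms by auto
  have 6: "\<not> R (q + 4)" using R1 5 redD[of 4 1 "q + 4"] assms by auto
  show False using 3 4 6 blueD[of 2 "q + 2" "q + 4"] assms by auto
qed

lemma red_one_if_s_eq_1:
  assumes "s = 1" "1 \<le> q" "q \<le> 2 * m" "2 * m \<le> q + 1" "N = 2 * q + 2 * m + 1"
  shows "R 1"
proof (rule ccontr)
  assume B1: "\<not> R 1"
  have R2: "R 2" using B1 blueD[of 1 1 2] assms by auto
  have B: "\<not> R (2 * q + 2)" using R2 redD[of 2 2 "2 * q + 2"] assms by auto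
  have odds: "\<not> R (2 * int k + 1)" if "int k \<le> m" for k
    using that
  proof (induction k)
    case 0
    then show ?case using B1 by simp
  next
    case (Suc k)
    \<comment> \<open>The red number is also (2 k + 3) + q * 2, so red 2 makes 2 k + 3 blue. For k +
      1 = m it equals \<open>N\<close>.\<close>
    then have "R (2 * q + 2 * int k + 3)"
      using B blueD[of "2 * int k + 1" "2 * q + 2" "2 * q + 2 * int k + 3"] assms by auto
    then show ?case
      using Suc.prems R2 redD[of "2 * int k + 3" 2 "2 * q + 2 * int k + 3"] assms
      by (auto simp: algebra_simps)
  qed
  \<comment> \<open>2 m + 1 is the largest odd number known to be blue; its complement in 2 q + 2 is
    2 (q - m) + 1, which is covered since q \<le> 2 m.\<close>
  define a where "a = nat m"
  define b where "b = nat (q - m)"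
  have "int a = m" "int b = q - m" "int b \<le> m"
    using assms by (auto simp: a_def b_def)
  then show False
    using odds[of a] odds[of b] B blueD[of "2 * m + 1" "2 * (q - m) + 1" "2 * q + 2"] assms
    by (auto simp: algebra_simps)
qed

lemma not_red_one_if_s_ge_2:
  assumes "2 \<le> s" "s \<le> q" "N = (q + 1) * (s + 1) + s"
  shows "\<not> R 1"
proof
  assume R1: "R 1"
  have N: "N = q * s + q + 2 * s + 1" using assms by (simp add: algebra_simps)
  have "s * s \<le> q * s" "2 * s \<le> q * s" "q * 2 \<le> q * s"
    using assms by (auto intro: mult_mono)
  \<comment> \<open>Equivalent to 2 q + 1 + s (s + 1) \<le> \<open>N\<close>, the largest number in
    the refutation of a red 2.\<close>
  have "0 \<le> (q - s) * (s - 1)" using assms by (intro mult_nonneg_nonneg) auto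
  then have ss: "s * s + q \<le> q * s + s" by (simp add: algebra_simps)
  note bounds = N \<open>s * s \<le> q * s\<close> \<open>2 * s \<le> q * s\<close> \<open>q * 2 \<le> q * s\<close> ss assms(1,2)
  have 1: "\<not> R (q + 1)" using R1 redD[of 1 1 "q + 1"] bounds by auto
  have 2: "R ((q + 1) * (s + 1))"
    using 1 blueD[of "q + 1" "q + 1" "(q + 1) * (s + 1)"] bounds by (auto simp: algebra_simps)
  have 3: "\<not> R (s + 1)"
    using 2 redD[of "s + 1" "s + 1" "(q + 1) * (s + 1)"] bounds by (auto simp: algebra_simps)
  \<comment> \<open>From blue q + 1, go up by s (s + 1), up by q, and down by s (s + 1): 2 q + 1
    becomes red, but red 1 and 2 make it blue.\<close>
  have B2: "\<not> R 2"
  proof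
    assume R2: "R 2"
    have 4: "R (q + 1 + s * (s + 1))"
      using 1 3 blueD[of "q + 1" "s + 1" "q + 1 + s * (s + 1)"] bounds by (auto simp: algebra_simps)
    have 5: "\<not> R (2 * q + 1 + s * (s + 1))"
      using R1 4 redD[of "q + 1 + s * (s + 1)" 1 "2 * q + 1 + s * (s + 1)"] bounds
      by (auto simp: algebra_simps)
    have 6: "R (2 * q + 1)"
      using 3 5 blueD[of "2 * q + 1" "s + 1" "2 * q + 1 + s * (s + 1)"] bounds
      by (auto simp: algebra_simps)
    show False using R1 R2 6 redD[of 1 2 "2 * q + 1"] bounds by auto
  qed
  have B4: "\<not> R 4"
  proof
    assume R4: "R 4"
    show False
    proof (cases "s = 2")
      case True
      have 4: "\<not> R (q + 4)" using R1 R4 redD[of 4 1 "q + 4"] bounds by auto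
      have 5: "R (q + 8)" using 4 B2 blueD[of "q + 4" 2 "q + 8"] bounds True by auto
      have 6: "R 8" using B2 3 blueD[of 2 3 8] bounds True by auto
      show False using R1 5 6 redD[of 8 1 "q + 8"] bounds True by auto
    next
      case False
      \<comment> \<open>This puts 4 q + 2 s + 1 inside the interval. Detours by 2 s carry the chain
        from q + 1 to 4 q + 1.\<close>
      then have "q * 3 \<le> q * s" using assms by (auto intro: mult_mono)
      note bounds = bounds this
      have 4: "R (q + 2 * s + 1)"
        using 1 B2 blueD[of "q + 1" 2 "q + 2 * s + 1"] bounds by auto
      have 5: "\<not> R (2 * q + 2 * s + 1)"
        using R1 4 redD[of "q + 2 * s + 1" 1 "2 * q + 2 * s + 1"] bounds by auto
      have 6: "R (2 * q + 1)"
        using B2 5 blueD[of "2 * q + 1" 2 "2 * q + 2 * s + 1"] bounds by auto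
      have 7: "\<not> R (3 * q + 1)"
        using R1 6 redD[of "2 * q + 1" 1 "3 * q + 1"] bounds by auto
      have 8: "R (3 * q + 2 * s + 1)"
        using B2 7 blueD[of "3 * q + 1" 2 "3 * q + 2 * s + 1"] bounds by auto
      have 9: "\<not> R (4 * q + 2 * s + 1)"
        using R1 8 redD[of "3 * q + 2 * s + 1" 1 "4 * q + 2 * s + 1"] bounds by auto
      have 10: "R (4 * q + 1)"
        using B2 9 blueD[of "4 * q + 1" 2 "4 * q + 2 * s + 1"] bounds by auto
      show False using R1 R4 10 redD[of 1 4 "4 * q + 1"] bounds by auto
    qed
  qed
  show False
  proof (cases "q = 2")
    case True
    then have "s = 2" using assms by simp
    have "R 6" using B2 blueD[of 2 2 6] bounds \<open>s = 2\<close> True by auto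
    moreover have "R 8" using B2 3 blueD[of 2 3 8] bounds \<open>s = 2\<close> True by auto
    ultimately show False using R1 redD[of 6 1 8] bounds True by auto
  next
    case False
    \<comment> \<open>This puts q + 5 s + 1 inside the interval. The chain makes 5 s + 1 blue,
      against blue s + 1 and 4.\<close>
    then have "3 * s \<le> q * s" using assms by (intro mult_right_mono) auto
    note bounds = bounds this
    have 4: "R (3 * s + 1)" using 3 B2 blueD[of "s + 1" 2 "3 * s + 1"] bounds by auto
    have 5: "\<not> R (q + 3 * s + 1)"
      using R1 4 redD[of "3 * s + 1" 1 "q + 3 * s + 1"] bounds by auto
    have 6: "R (q + 5 * s + 1)"
      using B2 5 blueD[of "q + 3 * s + 1" 2 "q + 5 * s + 1"] bounds by auto
    have 7: "\<not> R (5 * s + 1)"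
      using R1 6 redD[of "5 * s + 1" 1 "q + 5 * s + 1"] bounds by auto
    show False using 3 B4 7 blueD[of "s + 1" 4 "5 * s + 1"] bounds by auto
  qed
qed

lemma red_one_if_s_ge_2:
  assumes "2 \<le> s" "s \<le> q" "N = (q + 1) * (s + 1) + s"
  shows "R 1"
proof (rule ccontr)
  assume B1: "\<not> R 1"
  have N: "N = q * s + q + 2 * s + 1" using assms by (simp add: algebra_simps)
  have "2 * s \<le> q * s" "q * 2 \<le> q * s"
    using assms by (auto intro: mult_mono)
  note bounds = N this assms(1,2)
  have 1: "R (s + 1)" using B1 blueD[of 1 1 "s + 1"] bounds by auto
  have 2: "\<not> R ((q + 1) * (s + 1))"
    using 1 redD[of "s + 1" "s + 1" "(q + 1) * (s + 1)"] bounds by (auto simp: algebra_simps)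
  \<comment> \<open>The full length of the interval enters here: \<open>N\<close> is also (2 s + 1)
    + q (s + 1), which makes 2 s + 1 blue.\<close>
  have 3: "R N"
    using B1 2 blueD[of "(q + 1) * (s + 1)" 1 N] bounds by (auto simp: algebra_simps)
  have 4: "\<not> R (2 * s + 1)"
    using 1 3 redD[of "2 * s + 1" "s + 1" N] bounds by (auto simp: algebra_simps)
  have R2: "R 2" using B1 4 blueD[of 1 2 "2 * s + 1"] bounds by auto
  show False
  proof (cases "s = 2")
    case True
    have 5: "R (3 * q + 1)"
      using B1 2 blueD[of "3 * q + 1" 1 "3 * q + 3"] bounds True by (auto simp: algebra_simps)
    have 6: "\<not> R (q + 1)" using R2 5 redD[of "q + 1" 2 "3 * q + 1"] bounds by auto
    have 7: "\<not> R (2 * q + 3)" using 1 R2 redD[of 3 2 "2 * q + 3"] bounds True by auto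
    show False using B1 6 7 blueD[of 1 "q + 1" "2 * q + 3"] bounds True by auto
  next
    case False
    \<comment> \<open>One third of the first bound and two thirds of the second give q + 2 s \<le> q
      s, that is, 2 q + 4 s + 1 \<le> \<open>N\<close>.\<close>
    then have "q * 3 \<le> q * s" "3 * s \<le> q * s" using assms by (auto intro: mult_mono)
    note bounds = bounds this False
    show False
    proof (cases "R 4")
      case True
      have 5: "\<not> R (2 * q + 2)" using R2 redD[of 2 2 "2 * q + 2"] bounds by auto
      have 6: "R (2 * q + s + 2)"
        using B1 5 blueD[of "2 * q + 2" 1 "2 * q + s + 2"] bounds by auto
      have 7: "\<not> R (4 * q + s + 2)"
        using R2 6 redD[of "2 * q + s + 2" 2 "4 * q + s + 2"] bounds by auto
      have 8: "R (4 * q + 2)"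
        using B1 7 blueD[of "4 * q + 2" 1 "4 * q + s + 2"] bounds by auto
      show False using R2 True 8 redD[of 2 4 "4 * q + 2"] bounds by auto
    next
      case B4: False
      have 5: "R (3 * s + 1)"
        using B1 4 blueD[of "2 * s + 1" 1 "3 * s + 1"] bounds by auto
      have 6: "\<not> R (2 * q + 3 * s + 1)"
        using R2 5 redD[of "3 * s + 1" 2 "2 * q + 3 * s + 1"] bounds by auto
      have 7: "R (2 * q + 4 * s + 1)"
        using B1 6 blueD[of "2 * q + 3 * s + 1" 1 "2 * q + 4 * s + 1"] bounds by auto
      have 8: "\<not> R (4 * s + 1)"
        using R2 7 redD[of "4 * s + 1" 2 "2 * q + 4 * s + 1"] bounds by auto
      show False using B1 B4 8 blueD[of 1 4 "4 * s + 1"] bounds by auto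
    qed
  qed
qed

end

theorem theorem3p1:
  fixes q s :: int
  assumes "1 \<le> s" and "s \<le> q"
  shows "RR1 q s =
    Some (if s = 1 then 2 * q + 2 * \<lfloor>(real_of_int q + 1) / 2\<rfloor> + 1
          else (q + 1) * (s + 1) + s)"
proof (cases "s = 1")
  case True
  define m where "m = (q + 1) div 2"
  have m: "q \<le> 2 * m" "2 * m \<le> q + 1" by (auto simp: m_def)
  have "\<lfloor>(real_of_int q + 1) / 2\<rfloor> = m"
    using floor_divide_of_int_eq[of "q + 1" 2, where 'a = real] by (simp add: m_def)
  moreover have "RR1 q s = Some (2 * q + 2 * m + 1)"
  proof (rule RR1_eqI)
    show "good_colouring q s (2 * q + 2 * m + 1 - 1)
        (\<lambda>x. \<not> (odd x \<and> x < 2 * m) \<and> \<not> (even x \<and> 2 * q + 2 \<le> x))"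
      using good_colouring_parity[of q m] assms m True by simp
    show "\<not> good_colouring q s (2 * q + 2 * m + 1) R" for R
      using good_colouring.not_red_one_if_s_eq_1[of q s "2 * q + 2 * m + 1" R]
        good_colouring.red_one_if_s_eq_1[of q s "2 * q + 2 * m + 1" R m] assms m True by auto
  qed (use assms m in auto)
  ultimately show ?thesis using True by simp
next
  case False
  then have "2 \<le> s" using assms by simp
  have "RR1 q s = Some ((q + 1) * (s + 1) + s)"
  proof (rule RR1_eqI)
    show "good_colouring q s ((q + 1) * (s + 1) + s - 1) (\<lambda>x. s + 1 \<le> x \<and> x < (q + 1) * (s + 1))"
      using good_colouring_interval assms by blast
    show "\<not> good_colouring q s ((q + 1) * (s + 1) + s) R" for R
      using good_colouring.not_red_one_if_s_ge_2 good_colouring.red_one_if_s_ge_2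
        \<open>2 \<le> s\<close> \<open>s \<le> q\<close> by blast
    have "0 \<le> (q + 1) * (s + 1)" using assms by simp
    then show "1 \<le> (q + 1) * (s + 1) + s" using assms by linarith
  qed (use assms in auto)
  then show ?thesis using False by simp
qed

end
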